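(* Let $\rho_1>0$ and $\nu_2>0$ be fixed and let $\rho_2=\nu_2C$. If $\nu_2>\max(4,e/\rho_1)$, there exists $C_0>0$ such that, if $C\ge C_0$, the dynamical system (D1) associated to the RIST algorithm with one retrial has exactly three equilibrium points. Identifying an equilibrium point $\Lambda^*$ with its value $S=\Lambda^*(\mathcal{X}_+^c)$, these three equilibrium points converge respectively to $$0,\qquad\frac{1-\sqrt{1-4/\nu_2}}{2},\qquad\frac{1+\sqrt{1-4/\nu_2}}{2},$$ as $C$ goes to infinity.
   Context: Let $C\ge1$ be an integer, $\lambda,\mu_1,\mu_2>0$, $\rho_1=\lambda/\mu_1$, $\rho_2=\lambda/\mu_2$. Let $\mathcal{X}=\{(x,y)\in\mathbb{N}^2:x+y\le C\}$, $\mathcal{X}_+=\{(x,y):x+y<C\}$, $\mathcal{X}_+^c=\mathcal{X}\setminus\mathcal{X}_+$. For $f:\mathcal{X}\to\mathbb{R}$ put $\nabla_1^{\pm}(f)(x,y)=f(x\pm1,y)-f(x,y)$, $\nabla_2^{\pm}(f)(x,y)=f(x,y\pm1)-f(x,y)$, $I_1(x,y)=x$, $I_2(x,y)=y$ (products with $\mathbf{1}_{\mathcal{X}_+}$ or $I_i$ are $0$ where these vanish), and $\langle\zeta,f\rangle=\sum_{z\in\mathcal{X}}f(z)\zeta(z)$. The system (D1) is, for a function $(\Lambda(t))$ with values in the probability distributions on $\mathcal{X}$ and all $f:\mathcal{X}\to\mathbb{R}$, $$\frac{\mathrm{d}}{\mathrm{d}t}\langle\Lambda(t),f\rangle=\lambda\langle\Lambda(t),\nabla_1^+(f)\mathbf{1}_{\mathcal{X}_+}\rangle+\mu_1\langle\Lambda(t),I_1\nabla_1^-(f)\rangle+\lambda\Lambda(t)(\mathcal{X}_+^c)\langle\Lambda(t),\nabla_2^+(f)\mathbf{1}_{\mathcal{X}_+}\rangle+\mu_2\langle\Lambda(t),I_2\nabla_2^-(f)\rangle.$$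 Its equilibrium points are the distributions $\pi_S(x,y)=\frac1{Z_S}\frac{\rho_1^x}{x!}\frac{(\rho_2S)^y}{y!}$, $(x,y)\in\mathcal{X}$ ($Z_S$ the normalization constant), where $S=\pi_S(\mathcal{X}_+^c)$, i.e. where $z=S\in(0,1)$ is a solution of $$\frac{(\rho_1+\rho_2z)^C}{C!}-z\sum_{m=0}^C\frac{(\rho_1+\rho_2z)^m}{m!}=0.$$ *)

theory Defs
  imports "HOL-Probability.Probability"
begin

definition states :: "nat \<Rightarrow> (nat \<times> nat) set" where
  "states C = {(x, y). x + y \<le> C}"

definition free_states :: "nat \<Rightarrow> (nat \<times> nat) set" where
  "free_states C = {(x, y). x + y < C}"

definition full_states :: "nat \<Rightarrow> (nat \<times> nat) set" where
  "full_states C = states C - free_states C"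

definition distributions :: "nat \<Rightarrow> (nat \<times> nat) pmf set" where
  "distributions C = {p. set_pmf p \<subseteq> states C}"

definition pairing :: "nat \<Rightarrow> (nat \<times> nat) pmf \<Rightarrow> (nat \<times> nat \<Rightarrow> real) \<Rightarrow> real" where
  "pairing C p f = (\<Sum>z\<in>states C. f z * pmf p z)"

definition full_prob :: "nat \<Rightarrow> (nat \<times> nat) pmf \<Rightarrow> real" where
  "full_prob C p = measure_pmf.prob p (full_states C)"

definition nabla1_plus :: "(nat \<times> nat \<Rightarrow> real) \<Rightarrow> nat \<times> nat \<Rightarrow> real" where
  "nabla1_plus f = (\<lambda>(x, y). f (x + 1, y) - f (x, y))"

definition nabla2_plus :: "(nat \<times> nat \<Rightarrow> real) \<Rightarrow> nat \<times> nat \<Rightarrow> real" where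
  "nabla2_plus f = (\<lambda>(x, y). f (x, y + 1) - f (x, y))"

text \<open>Natural-number subtraction truncates, so the two backward differences have junk values
  on the axes \<open>x = 0\<close> and \<open>y = 0\<close> respectively; they only occur multiplied by \<open>x\<close>,
  respectively \<open>y\<close>.\<close>

definition nabla1_minus :: "(nat \<times> nat \<Rightarrow> real) \<Rightarrow> nat \<times> nat \<Rightarrow> real" where
  "nabla1_minus f = (\<lambda>(x, y). f (x - 1, y) - f (x, y))"

definition nabla2_minus :: "(nat \<times> nat \<Rightarrow> real) \<Rightarrow> nat \<times> nat \<Rightarrow> real" where
  "nabla2_minus f = (\<lambda>(x, y). f (x, y - 1) - f (x, y))"

definition drift ::
  "nat \<Rightarrow> real \<Rightarrow> real \<Rightarrow> real \<Rightarrow> (nat \<times> nat) pmf \<Rightarrow> (nat \<times> nat \<Rightarrow> real) \<Rightarrow> real" where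
  "drift C lam mu1 mu2 p f =
     lam * pairing C p (\<lambda>z. nabla1_plus f z * indicator (free_states C) z)
     + mu1 * pairing C p (\<lambda>z. real (fst z) * nabla1_minus f z)
     + lam * full_prob C p * pairing C p (\<lambda>z. nabla2_plus f z * indicator (free_states C) z)
     + mu2 * pairing C p (\<lambda>z. real (snd z) * nabla2_minus f z)"

text \<open>Test functions are total on \<open>nat \<times> nat\<close>, but both sides of the equation below depend only
  on their restriction to \<open>states C\<close>.\<close>

definition solves_D1 ::
  "nat \<Rightarrow> real \<Rightarrow> real \<Rightarrow> real \<Rightarrow> (real \<Rightarrow> (nat \<times> nat) pmf) \<Rightarrow> bool" where
  "solves_D1 C lam mu1 mu2 L \<longleftrightarrow>
     (\<forall>t\<ge>0. L t \<in> distributions C) \<and>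
     (\<forall>f. \<forall>t\<ge>0. ((\<lambda>s. pairing C (L s) f) has_real_derivative drift C lam mu1 mu2 (L t) f)
                  (at t within {0..}))"

definition equilibria ::
  "nat \<Rightarrow> real \<Rightarrow> real \<Rightarrow> real \<Rightarrow> (nat \<times> nat) pmf set" where
  "equilibria C lam mu1 mu2 = {p. solves_D1 C lam mu1 mu2 (\<lambda>t. p)}"

end

theory Submission
  imports Defs "HOL-Real_Asymp.Real_Asymp"
begin

text \<open>
  The drift is a sum of fluxes over the edges of \<open>free_states C\<close>. Dividing an equilibrium by the
  detailed-balance weights and testing with this quotient turns the drift into a Dirichlet form,
  so the equilibria are exactly the product-form distributions whose parameter \<open>S\<close> is a positive
  zero of \<open>gap\<close>.

  In the variable \<open>a = rho1 + nu2 C z\<close> the gap is a polynomial with three sign changes, so by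
  Descartes' rule it has at most three positive zeros. On the other hand, for fixed \<open>z \<in> (0, 1)\<close>
  and large \<open>C\<close> its sign is that of \<open>nu2 z (1 - z) - 1\<close>, and it is positive at \<open>z = 0\<close>; so it
  has zeros close to \<open>0\<close> and to the two roots of \<open>nu2 z (1 - z) = 1\<close>.
\<close>

section \<open>Truncated exponential sums and the sign of the gap\<close>

definition mass :: "nat \<Rightarrow> real \<Rightarrow> real" where
  "mass C a = (\<Sum>m\<le>C. a ^ m / fact m)"

text \<open>The quotient of \<open>a ^ C / fact C\<close> by \<open>mass C a\<close> is the Erlang
  blocking probability of a loss system with \<open>C\<close> servers and load \<open>a\<close>;
  \<open>gap\<close> compares it with \<open>z\<close>, denominators cleared.\<close>

definition gap :: "real \<Rightarrow> real \<Rightarrow> nat \<Rightarrow> real \<Rightarrow> real" where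
  "gap r nu C z = (let a = r + nu * real C * z in a ^ C / fact C - z * mass C a)"

lemma mass_pos: "a \<ge> 0 \<Longrightarrow> mass C a > 0"
  unfolding mass_def by (intro sum_pos2[where i = 0]) auto

text \<open>For \<open>m > 0\<close> the term \<open>m * a ^ m / fact m\<close> is \<open>a\<close>
  times the preceding term of the exponential series, so weighting by \<open>m\<close> multiplies
  the sum by \<open>a\<close> up to a boundary term at \<open>C\<close>.\<close>

lemma sum_diff_mult_power_div_fact:
  fixes a r :: real
  shows "(\<Sum>m\<le>C. (r - real m) * (a ^ m / fact m)) = (r - a) * mass C a + a ^ Suc C / fact C"
proof (induction C)
  case 0
  show ?case by (simp add: mass_def)
next
  case (Suc C)
  have "a ^ Suc C / fact C = real (Suc C) * (a ^ Suc C / fact (Suc C))"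
    by (simp add: fact_Suc del: of_nat_Suc power_Suc)
  with Suc show ?case
    unfolding sum.atMost_Suc mass_def by (simp add: algebra_simps diff_divide_distrib add_divide_distrib del: fact_Suc)
qed

lemma continuous_on_gap: "continuous_on A (gap r nu C)"
  unfolding gap_def[abs_def] mass_def Let_def by (intro continuous_intros) auto

text \<open>A Poisson law truncated at \<open>C\<close> has mean at most \<open>C\<close>, which
  bounds the blocking probability below by \<open>1 - C / a\<close>. The hypothesis on
  \<open>z\<close>, made strict by \<open>r * (1 - z) > 0\<close>, puts \<open>z\<close> below this
  bound.\<close>

lemma gap_pos:
  assumes "r > 0" "nu > 0" "C > 0" "0 < z" "z < 1" "nu * z * (1 - z) \<ge> 1"
  shows "gap r nu C z > 0"
proof -
  define a where "a = r + nu * real C * z"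
  have a: "a > 0" using assms by (simp add: a_def add_pos_nonneg)
  have "0 \<le> (\<Sum>m\<le>C. (real C - real m) * (a ^ m / fact m))"
    using a by (intro sum_nonneg mult_nonneg_nonneg) auto
  then have 1: "(a - C) * mass C a \<le> a * (a ^ C / fact C)"
    unfolding sum_diff_mult_power_div_fact by (simp add: algebra_simps)
  have "real C * 1 \<le> real C * (nu * z * (1 - z))"
    using assms by (intro mult_left_mono) auto
  moreover have "r * (1 - z) > 0" using assms by simp
  ultimately have "a * (1 - z) > C" by (simp add: a_def algebra_simps)
  then have "a * z < a - C" by (simp add: algebra_simps)
  then have "a * z * mass C a < (a - C) * mass C a"
    using a by (intro mult_strict_right_mono mass_pos) auto
  with 1 have "a * (z * mass C a) < a * (a ^ C / fact C)" by (simp add: mult.assoc)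
  with a have "z * mass C a < a ^ C / fact C" by (simp only: mult_less_cancel_left_pos)
  then show ?thesis by (simp add: gap_def Let_def a_def)
qed

text \<open>The terms of \<open>mass C a\<close> are read downwards from the top one. For fixed
  \<open>i\<close> and \<open>a\<close> growing linearly in \<open>C\<close> the ratios
  \<open>(C - i) / a\<close> converge, so near its top the sum looks geometric.\<close>

lemma power_div_fact_diff:
  fixes a :: real
  assumes "a > 0" "k \<le> C"
  shows "a ^ (C - k) / fact (C - k) = a ^ C / fact C * (\<Prod>i<k. (real C - real i) / a)"
  using assms(2)
proof (induction k)
  case 0
  show ?case by simp
next
  case (Suc k)
  then have "C - k = Suc (C - Suc k)" by simp
  then have "a ^ (C - Suc k) / fact (C - Suc k)
      = a ^ (C - k) / fact (C - k) * (real (C - k) / a)"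
    using assms(1) by (simp add: field_simps)
  with Suc show ?case by (simp add: of_nat_diff)
qed

text \<open>For \<open>q < 1\<close> the partial sums tend to \<open>1 / (1 - q) > 1 / z\<close>;
  otherwise they are unbounded. A fixed number of terms allows a termwise limit in
  \<open>eventually_gap_neg\<close>.\<close>

lemma geometric_sum_exceeds:
  fixes q z :: real
  assumes "0 < q" "0 < z" "1 - q < z"
  obtains K where "(\<Sum>k\<le>K. q ^ k) > 1 / z"
proof (cases "q < 1")
  case True
  have "(\<lambda>K. \<Sum>k\<le>K. q ^ k) \<longlonglongrightarrow> 1 / (1 - q)"
    using geometric_sums[of q] True assms unfolding sums_def_le by simp
  moreover have "1 / z < 1 / (1 - q)"
    using True assms by (intro divide_strict_left_mono) auto
  ultimately have "\<forall>\<^sub>F K in sequentially. 1 / z < (\<Sum>k\<le>K. q ^ k)"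
    by (rule order_tendstoD)
  then show ?thesis using that eventually_happens'[OF sequentially_bot] by blast
next
  case False
  obtain K :: nat where K: "1 / z < real K" using reals_Archimedean2 by blast
  have "real K \<le> (\<Sum>k\<le>K. 1)" by simp
  also have "\<dots> \<le> (\<Sum>k\<le>K. q ^ k)"
    using False by (intro sum_mono) (auto intro: one_le_power)
  finally show ?thesis using K that by (metis less_le_trans)
qed

text \<open>Relative to the top term, the last \<open>K + 1\<close> terms of \<open>mass\<close>
  tend to \<open>q ^ k\<close> with \<open>q = 1 / (nu * z)\<close>. The last hypothesis says
  \<open>1 - q < z\<close>, so for suitable \<open>K\<close> their sum exceeds
  \<open>1 / z\<close>.\<close>

lemma eventually_gap_neg:
  assumes "r > 0" "nu > 0" "0 < z" "nu * z * (1 - z) < 1"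
  shows "\<forall>\<^sub>F C in sequentially. gap r nu C z < 0"
proof -
  define q where "q = 1 / (nu * z)"
  have q: "q > 0" using assms by (simp add: q_def)
  have "1 - q < z" using assms by (simp add: q_def field_simps)
  with q assms obtain K where K: "(\<Sum>k\<le>K. q ^ k) > 1 / z"
    using geometric_sum_exceeds by blast
  define a where "a C = r + nu * real C * z" for C
  have a: "a C > 0" for C using assms by (simp add: a_def add_pos_nonneg)
  have lim1: "(\<lambda>C. (real C - real i) / a C) \<longlonglongrightarrow> q" for i
  proof -
    have "(\<lambda>C. (real C - real i) / (r + k * real C)) \<longlonglongrightarrow> 1 / k" if "k > 0" for k :: real
      using that by (real_asymp simp: divide_inverse)
    from this[of "nu * z"] assms show ?thesis by (simp add: a_def q_def mult_ac)
  qed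
  have "(\<lambda>C. \<Sum>k\<le>K. \<Prod>i<k. (real C - real i) / a C) \<longlonglongrightarrow> (\<Sum>k\<le>K. \<Prod>i<k. q)"
    by (intro tendsto_sum tendsto_prod lim1)
  then have "\<forall>\<^sub>F C in sequentially. 1 / z < (\<Sum>k\<le>K. \<Prod>i<k. (real C - real i) / a C)"
    using K by (intro order_tendstoD) auto
  \<comment> \<open>\<open>C \<ge> K\<close> keeps \<open>C - k\<close> from truncating, as the
    ratio formula and the injectivity of the reindexing require.\<close>
  with eventually_ge_at_top[of K] show ?thesis
  proof eventually_elim
    case (elim C)
    let ?t = "a C ^ C / fact C"
    have t: "?t > 0" using a by simp
    have "?t < z * (?t * (\<Sum>k\<le>K. \<Prod>i<k. (real C - real i) / a C))"
      using elim(2) t assms(3) by (simp add: field_simps)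
    also have "?t * (\<Sum>k\<le>K. \<Prod>i<k. (real C - real i) / a C)
        = (\<Sum>k\<le>K. a C ^ (C - k) / fact (C - k))"
      unfolding sum_distrib_left using elim(1) a by (intro sum.cong) (simp_all only: power_div_fact_diff atMost_iff le_trans[of _ K C])
    also have "\<dots> = (\<Sum>m\<in>(\<lambda>k. C - k) ` {..K}. a C ^ m / fact m)"
      using elim(1) by (subst sum.reindex) (auto simp: inj_on_def)
    also have "\<dots> \<le> mass C (a C)"
      unfolding mass_def using a[of C] by (intro sum_mono2) auto
    finally show ?case using assms(3) by (simp add: gap_def Let_def a_def)
  qed
qed

section \<open>At most three zeros: Descartes' rule by repeated use of Rolle\<close>

text \<open>The coefficients of \<open>nu * C * gap\<close> as a polynomial in \<open>a = r + nu * C * z\<close>; their signs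
  change only at \<open>r\<close>, between \<open>C - 1\<close> and \<open>C\<close>, and between \<open>C\<close> and \<open>C + 1\<close>.\<close>

definition gap_coeff :: "real \<Rightarrow> real \<Rightarrow> nat \<Rightarrow> nat \<Rightarrow> real" where
  "gap_coeff r b C m =
     (if m = Suc C then - 1 / fact C
      else if m = C then (r - real C + b) / fact C
      else (r - real m) / fact m)"

text \<open>For \<open>b = nu * C\<close> the right-hand side is \<open>b\<close> times the gap,
  because \<open>b * z = a - r\<close>. The boundary term of
  \<open>sum_diff_mult_power_div_fact\<close> supplies the coefficient of degree
  \<open>C + 1\<close>.\<close>

lemma gap_coeff_sum:
  "(\<Sum>m\<le>Suc C. gap_coeff r b C m * a ^ m) = (r - a) * mass C a + b * (a ^ C / fact C)"
proof -
  have "(\<Sum>m\<le>C. gap_coeff r b C m * a ^ m)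
      = (\<Sum>m\<le>C. (r - real m) * (a ^ m / fact m) + (if m = C then b * (a ^ C / fact C) else 0))"
    by (intro sum.cong) (auto simp: gap_coeff_def field_simps)
  then have "(\<Sum>m\<le>C. gap_coeff r b C m * a ^ m)
      = (r - a) * mass C a + a ^ Suc C / fact C + b * (a ^ C / fact C)"
    unfolding sum.distrib sum_diff_mult_power_div_fact by simp
  then show ?thesis by (simp add: gap_coeff_def)
qed

text \<open>Rolle for \<open>t powr (-s)\<close> times the polynomial, which has the same positive
  zeros. The factor \<open>m - s\<close> flips the signs of the coefficients below \<open>s\<close>
  only, so placing \<open>s\<close> at a sign change removes it: the induction step of Descartes'
  rule.\<close>

lemma Rolle_power_sum:
  fixes c :: "nat \<Rightarrow> real"
  assumes "0 < x" "x < y" "(\<Sum>m\<le>N. c m * x ^ m) = 0" "(\<Sum>m\<le>N. c m * y ^ m) = 0"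
  shows "\<exists>z>x. z < y \<and> (\<Sum>m\<le>N. (real m - s) * c m * z ^ m) = 0"
proof -
  define g where "g t = t powr (-s) * (\<Sum>m\<le>N. c m * t ^ m)" for t
  define g' where "g' t = t powr (-s - 1) * (\<Sum>m\<le>N. (real m - s) * c m * t ^ m)" for t
  have deriv: "(g has_real_derivative g' t) (at t)" if "t > 0" for t
  proof -
    have "(g has_real_derivative
        ((-s) * t powr (-s - 1)) * (\<Sum>m\<le>N. c m * t ^ m)
        + (\<Sum>m\<le>N. c m * (real m * t ^ (m - 1))) * t powr (-s)) (at t)"
      unfolding g_def using that
      by (auto intro!: derivative_eq_intros sum.cong simp: mult_ac)
    moreover have "(-s * t powr (-s - 1)) * (\<Sum>m\<le>N. c m * t ^ m)
        + (\<Sum>m\<le>N. c m * (real m * t ^ (m - 1))) * t powr (-s) = g' t"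
    proof -
      have pw: "t powr (-s) = t powr (-s - 1) * t"
        using that by (simp add: powr_diff)
      have eq: "c m * (real m * t ^ (m - 1)) * t = real m * c m * t ^ m" for m
        by (cases m) auto
      have "(\<Sum>m\<le>N. (real m - s) * c m * t ^ m)
          = (\<Sum>m\<le>N. c m * (real m * t ^ (m - 1))) * t - s * (\<Sum>m\<le>N. c m * t ^ m)"
        unfolding sum_distrib_right sum_distrib_left sum_subtractf[symmetric] eq
        by (intro sum.cong) (simp_all add: left_diff_distrib)
      moreover have "(-s * W) * P + B * (W * t) = W * (B * t - s * P)" for W P B :: real
        by (simp add: algebra_simps)
      ultimately show ?thesis unfolding g'_def pw by simp
    qed
    ultimately show ?thesis by simp
  qed
  have "continuous_on {x..y} g"
    using assms(1) by (intro DERIV_continuous_on[of _ _ g']) (auto intro!: has_field_derivative_at_within[OF deriv])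
  moreover have "(g has_derivative (*) (g' t)) (at t)" if "x < t" "t < y" for t
    using deriv[of t] that assms(1) by (simp add: has_field_derivative_def)
  ultimately obtain z where z: "x < z" "z < y" "(*) (g' z) = (\<lambda>v. 0)"
    using Rolle_deriv[of x y g "\<lambda>t. (*) (g' t)"] assms by (auto simp: g_def)
  from fun_cong[OF z(3), of 1] have "g' z = 0" by simp
  with z assms(1) show ?thesis by (auto simp: g'_def)
qed

text \<open>The three factors sit at the three sign changes, so no coefficient stays positive. Below
  \<open>C\<close> each is minus a square times a product of two negative factors; the top one is
  strictly negative.\<close>

lemma gap_coeff_twisted_neg:
  assumes "real C > r" "r - real C + b > 0" "x > 0"
  shows "(\<Sum>m\<le>Suc C. (real m - (real C + 1/2)) * ((real m - (real C - 1/2)) *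
            ((real m - r) * gap_coeff r b C m)) * x ^ m) < 0"
proof -
  have neg: "(real m - (real C + 1/2)) * ((real m - (real C - 1/2)) *
            ((real m - r) * gap_coeff r b C m)) \<le> 0" if "m \<le> C" for m
  proof (cases "m = C")
    case True
    then show ?thesis using assms by (simp add: gap_coeff_def)
  next
    case False
    with that have "real m + 1 \<le> real C" by linarith
    moreover have "(real m - r) * gap_coeff r b C m = - ((real m - r)\<^sup>2 / fact m)"
      using False that by (simp add: gap_coeff_def power2_eq_square field_simps)
    ultimately show ?thesis
      by (simp add: mult_nonpos_nonpos mult_nonneg_nonneg divide_nonneg_pos
          mult_le_0_iff zero_le_mult_iff)
  qed
  have "(\<Sum>m\<le>C. (real m - (real C + 1/2)) * ((real m - (real C - 1/2)) *
            ((real m - r) * gap_coeff r b C m)) * x ^ m) \<le> 0"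
    using assms(3) by (intro sum_nonpos mult_nonpos_nonneg neg) auto
  moreover have "(real (Suc C) - (real C + 1/2)) * ((real (Suc C) - (real C - 1/2)) *
            ((real (Suc C) - r) * gap_coeff r b C (Suc C))) * x ^ Suc C < 0"
    using assms by (intro mult_neg_pos mult_pos_neg) (auto simp: gap_coeff_def)
  ultimately show ?thesis unfolding sum.atMost_Suc by linarith
qed

text \<open>Each Rolle step loses one zero: four zeros leave three for \<open>p1\<close>, two for
  \<open>p2\<close>, and one for a polynomial that is negative on the positive axis.\<close>

lemma gap_no_four_zeros:
  assumes r: "r > 0" "nu \<ge> 1" "real C > r"
    and z: "0 < z1" "z1 < z2" "z2 < z3" "z3 < z4"
    and gap0: "gap r nu C z1 = 0" "gap r nu C z2 = 0" "gap r nu C z3 = 0" "gap r nu C z4 = 0"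
  shows False
proof -
  define b where "b = nu * real C"
  have C: "real C > 0" using r by linarith
  \<comment> \<open>\<open>nu \<ge> 1\<close> gives \<open>b \<ge> C\<close>, hence a positive
    coefficient at \<open>C\<close>.\<close>
  have b: "b > 0" "r - real C + b > 0"
    using r C mult_right_mono[of 1 nu "real C"] unfolding b_def by (simp_all, linarith)
  define a where "a z = r + b * z" for z
  have mono: "a u < a v" if "u < v" for u v using that b by (simp add: a_def)
  have a1: "a z1 > 0" using r z b by (simp add: a_def add_pos_nonneg)
  have root: "(\<Sum>m\<le>Suc C. gap_coeff r b C m * a z ^ m) = 0" if "gap r nu C z = 0" for z
    using that unfolding gap_coeff_sum
    by (simp add: gap_def Let_def a_def b_def)
  define p1 where "p1 x = (\<Sum>m\<le>Suc C. (real m - r) * gap_coeff r b C m * x ^ m)" for x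
  define p2 where
    "p2 x = (\<Sum>m\<le>Suc C. (real m - (real C - 1/2)) * ((real m - r) * gap_coeff r b C m) * x ^ m)" for x
  have R1: "\<exists>w>x. w < y \<and> p1 w = 0"
    if "0 < x" "x < y" "(\<Sum>m\<le>Suc C. gap_coeff r b C m * x ^ m) = 0"
      "(\<Sum>m\<le>Suc C. gap_coeff r b C m * y ^ m) = 0" for x y
    unfolding p1_def by (rule Rolle_power_sum[OF that])
  have R2: "\<exists>w>x. w < y \<and> p2 w = 0" if "0 < x" "x < y" "p1 x = 0" "p1 y = 0" for x y
    unfolding p2_def by (rule Rolle_power_sum[OF that[unfolded p1_def]])
  have R3: False if "0 < x" "x < y" "p2 x = 0" "p2 y = 0" for x y
  proof -
    note Rolle = Rolle_power_sum[OF that[unfolded p2_def], of "real C + 1/2"]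
    obtain w where w: "w > x" and zero: "(\<Sum>m\<le>Suc C. (real m - (real C + 1/2)) *
        ((real m - (real C - 1/2)) * ((real m - r) * gap_coeff r b C m)) * w ^ m) = 0"
      using Rolle by blast
    have "w > 0" using w that(1) by simp
    from gap_coeff_twisted_neg[OF r(3) b(2) this] show False unfolding zero by simp
  qed
  have a: "0 < a z1" "a z1 < a z2" "a z2 < a z3" "a z3 < a z4" "0 < a z2" "0 < a z3"
    using a1 mono[OF z(2)] mono[OF z(3)] mono[OF z(4)] by linarith+
  obtain u1 where u1: "a z1 < u1" "u1 < a z2" "p1 u1 = 0"
    using R1[OF a(1,2)] root gap0 by blast
  obtain u2 where u2: "a z2 < u2" "u2 < a z3" "p1 u2 = 0"
    using R1[OF a(5,3)] root gap0 by blast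
  obtain u3 where u3: "a z3 < u3" "u3 < a z4" "p1 u3 = 0"
    using R1[OF a(6,4)] root gap0 by blast
  have u: "0 < u1" "u1 < u2" "0 < u2" "u2 < u3" using a u1 u2 u3 by linarith+
  obtain v1 where v1: "u1 < v1" "v1 < u2" "p2 v1 = 0"
    using R2[OF u(1,2) u1(3) u2(3)] by blast
  obtain v2 where v2: "u2 < v2" "v2 < u3" "p2 v2 = 0"
    using R2[OF u(3,4) u2(3) u3(3)] by blast
  show False by (rule R3[of v1 v2]) (use u v1 v2 in auto)
qed

section \<open>Three zeros for large \<open>C\<close> and their location\<close>

lemma gap_zero_between:
  assumes "x < y" "gap r nu C x * gap r nu C y < 0"
  shows "\<exists>z>x. z < y \<and> gap r nu C z = 0"
proof -
  have "\<exists>z\<ge>x. z \<le> y \<and> gap r nu C z = 0"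
    using assms IVT'[of "gap r nu C" x 0 y] IVT2'[of "gap r nu C" y 0 x] continuous_on_gap[of "{x..y}" r nu C]
    by (auto simp: mult_less_0_iff)
  then show ?thesis using assms by (metis less_eq_real_def less_irrefl mult_zero_left mult_zero_right)
qed

text \<open>\<open>D\<close> is the distance between the roots \<open>zm\<close> and
  \<open>zp\<close> of \<open>nu * z * (1 - z) = 1\<close>. The gap changes sign on
  \<open>(0, d)\<close> and on the intervals of radius \<open>d\<close> around both roots.\<close>

lemma eventually_three_gap_zeros:
  assumes "r > 0" "nu > 4" "e > 0"
  defines "D \<equiv> sqrt (1 - 4 / nu)"
  shows "\<forall>\<^sub>F C in sequentially. \<exists>s1 s2 s3. 0 < s1 \<and> s1 < s2 \<and> s2 < s3 \<and>
           gap r nu C s1 = 0 \<and> gap r nu C s2 = 0 \<and> gap r nu C s3 = 0 \<and>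
           \<bar>s1\<bar> < e \<and> \<bar>s2 - (1 - D) / 2\<bar> < e \<and> \<bar>s3 - (1 + D) / 2\<bar> < e"
proof -
  have D2: "D\<^sup>2 = 1 - 4 / nu" using assms by (simp add: D_def)
  have D: "0 < D" "D < 1" using assms by (auto simp: D_def)
  have fac: "nu * z * (1 - z) - 1 = - nu * (z - (1 - D) / 2) * (z - (1 + D) / 2)" for z
  proof -
    have "(z - (1 - D) / 2) * (z - (1 + D) / 2) = z\<^sup>2 - z + (1 - D\<^sup>2) / 4"
      by (simp add: power2_eq_square field_simps)
    also have "\<dots> = z\<^sup>2 - z + 1 / nu" by (simp add: D2)
    finally show ?thesis using assms
      by (simp add: mult.assoc power2_eq_square field_simps)
  qed
  define zm zp where "zm = (1 - D) / 2" and "zp = (1 + D) / 2"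
  have zz: "0 < zm" "zm < zp" "zp < 1" "1 - zp = zm" using D by (auto simp: zm_def zp_def field_simps)
  have neg: "nu * z * (1 - z) < 1" if "z < zm \<or> z > zp" for z
  proof -
    have "(z - zm) * (z - zp) > 0"
      using that zz by (auto simp: zero_less_mult_iff)
    then have "nu * ((z - zm) * (z - zp)) > 0" using assms by simp
    then show ?thesis using fac[of z] by (simp add: zm_def zp_def mult.assoc)
  qed
  have pos: "nu * z * (1 - z) \<ge> 1" if "zm < z" "z < zp" for z
  proof -
    have "(z - zm) * (z - zp) < 0"
      using that zz by (auto simp: mult_less_0_iff)
    then have "nu * ((z - zm) * (z - zp)) < 0" using assms by (simp add: mult_pos_neg)
    then show ?thesis using fac[of z] by (simp add: zm_def zp_def mult.assoc)
  qed
  \<comment> \<open>Below \<open>e\<close> for closeness; the thirds keep the three intervals apart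
    and, as \<open>1 - zp = zm\<close>, below 1.\<close>
  define d where "d = min (e / 2) (min (zm / 3) ((zp - zm) / 3))"
  have d: "0 < d" "d < e" "d < zm - d" "zm + d < zp - d" "zp + d < 1"
  proof -
    have "d \<le> e / 2" "d \<le> zm / 3" "d \<le> (zp - zm) / 3" unfolding d_def by linarith+
    moreover show "0 < d" using assms zz by (auto simp: d_def)
    ultimately show "d < e" "d < zm - d" "zm + d < zp - d" "zp + d < 1"
      using zz assms(3) by argo+
  qed
  note N = eventually_gap_neg[OF assms(1) _ _ neg]
  have "\<forall>\<^sub>F C in sequentially. gap r nu C d < 0 \<and> gap r nu C (zm - d) < 0 \<and> gap r nu C (zp + d) < 0"
    using assms d zz by (intro eventually_conj N) auto
  with eventually_gt_at_top[of 0] show ?thesis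
  proof eventually_elim
    case (elim C)
    \<comment> \<open>At \<open>z = 0\<close> the value \<open>r ^ C / fact C\<close> is positive
      for every \<open>C\<close>, while at the fixed \<open>d > 0\<close> the gap is eventually
      negative. This creates the zero tending to 0.\<close>
    have "gap r nu C 0 > 0" using assms by (simp add: gap_def)
    moreover have "gap r nu C (zm + d) > 0" "gap r nu C (zp - d) > 0"
      using assms elim d zz by (intro gap_pos pos; simp)+
    ultimately obtain s1 s2 s3 where
      "0 < s1" "s1 < d" "gap r nu C s1 = 0"
      "zm - d < s2" "s2 < zm + d" "gap r nu C s2 = 0"
      "zp - d < s3" "s3 < zp + d" "gap r nu C s3 = 0"
      using gap_zero_between[of 0 d r nu C] gap_zero_between[of "zm - d" "zm + d" r nu C]
        gap_zero_between[of "zp - d" "zp + d" r nu C] elim d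
      by (auto simp: mult_neg_pos mult_pos_neg)
    then show ?case using d unfolding zm_def[symmetric] zp_def[symmetric]
      by (intro exI[of _ s1] exI[of _ s2] exI[of _ s3]) auto
  qed
qed

text \<open>A further element would extend \<open>s1 < s2 < s3\<close> to a chain of length four,
  whichever gap it falls into.\<close>

lemma three_point_set_eqI:
  fixes A :: "'a::linorder set"
  assumes "s1 \<in> A" "s2 \<in> A" "s3 \<in> A" "s1 < s2" "s2 < s3"
    and no4: "\<And>x1 x2 x3 x4. \<lbrakk>x1 \<in> A; x2 \<in> A; x3 \<in> A; x4 \<in> A; x1 < x2; x2 < x3; x3 < x4\<rbrakk> \<Longrightarrow> False"
  shows "A = {s1, s2, s3}"
proof -
  have "x \<in> {s1, s2, s3}" if "x \<in> A" for x
  proof (rule ccontr)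
    assume "x \<notin> {s1, s2, s3}"
    then consider "x < s1" | "s1 < x" "x < s2" | "s2 < x" "x < s3" | "s3 < x"
      by (metis insertCI linorder_neqE)
    then show False
      by cases (use assms that no4 in blast)+
  qed
  with assms show ?thesis by blast
qed

section \<open>Product-form distributions on the state space\<close>

lemma finite_states: "finite (states C)"
  by (rule finite_subset[of _ "{..C} \<times> {..C}"]) (auto simp: states_def)

lemma free_states_subset: "free_states C \<subseteq> states C"
  by (auto simp: states_def free_states_def)

lemma finite_free_states: "finite (free_states C)"
  using finite_subset[OF free_states_subset finite_states] .

lemma full_states_eq: "full_states C = (\<lambda>x. (x, C - x)) ` {..C}"
  by (auto simp: full_states_def states_def free_states_def)

definition weight :: "real \<Rightarrow> real \<Rightarrow> nat \<times> nat \<Rightarrow> real" where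
  "weight a b = (\<lambda>(x, y). a ^ x / fact x * (b ^ y / fact y))"

text \<open>The binomial theorem, that is, the convolution of two Poisson weights. Summed over the
  diagonals it identifies the normalization constant as \<open>mass C (a + b)\<close>.\<close>

lemma sum_weight_full_states: "(\<Sum>z\<in>full_states C. weight a b z) = (a + b) ^ C / fact C"
proof -
  have "(\<Sum>z\<in>full_states C. weight a b z) = (\<Sum>x\<le>C. weight a b (x, C - x))"
    unfolding full_states_eq by (subst sum.reindex) (auto simp: inj_on_def)
  also have "\<dots> = (\<Sum>x\<le>C. of_nat (C choose x) * a ^ x * b ^ (C - x) / fact C)"
    by (intro sum.cong) (auto simp: weight_def binomial_fact)
  finally show ?thesis
    by (simp add: binomial_ring sum_divide_distrib)
qed

lemma sum_weight_states: "(\<Sum>z\<in>states C. weight a b z) = mass C (a + b)"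
proof (induction C)
  case 0
  have "states 0 = {(0, 0)}" by (auto simp: states_def)
  then show ?case by (simp add: weight_def mass_def)
next
  case (Suc C)
  have "states (Suc C) = states C \<union> full_states (Suc C)" "states C \<inter> full_states (Suc C) = {}"
    by (auto simp: states_def full_states_def free_states_def)
  then have "(\<Sum>z\<in>states (Suc C). weight a b z)
      = (\<Sum>z\<in>states C. weight a b z) + (\<Sum>z\<in>full_states (Suc C). weight a b z)"
    using finite_states by (simp add: sum.union_disjoint full_states_eq)
  then show ?case
    by (simp add: Suc sum_weight_full_states mass_def del: fact_Suc power_Suc)
qed

definition product_form :: "nat \<Rightarrow> real \<Rightarrow> real \<Rightarrow> (nat \<times> nat) pmf" where
  "product_form C a b =
     embed_pmf (\<lambda>z. if z \<in> states C then weight a b z / mass C (a + b) else 0)"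

lemma weight_nonneg: "a \<ge> 0 \<Longrightarrow> b \<ge> 0 \<Longrightarrow> weight a b z \<ge> 0"
  by (auto simp: weight_def split: prod.split)

lemma pmf_product_form:
  assumes "a \<ge> 0" "b \<ge> 0"
  shows "pmf (product_form C a b) z = (if z \<in> states C then weight a b z / mass C (a + b) else 0)"
  unfolding product_form_def
proof (rule pmf_embed_pmf)
  let ?g = "\<lambda>z. if z \<in> states C then weight a b z / mass C (a + b) else 0"
  have m: "mass C (a + b) > 0" using assms by (intro mass_pos) auto
  show nn: "0 \<le> ?g z" for z
    using assms m by (simp add: weight_nonneg)
  have "(\<integral>\<^sup>+z. ennreal (?g z) \<partial>count_space UNIV) = (\<Sum>z\<in>states C. ennreal (?g z))"
    by (rule nn_integral_count_space') (auto simp: finite_states)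
  also have "\<dots> = ennreal (\<Sum>z\<in>states C. ?g z)"
    by (intro sum_ennreal nn)
  also have "(\<Sum>z\<in>states C. ?g z) = 1"
    using m by (simp add: sum_weight_states flip: sum_divide_distrib)
  finally show "(\<integral>\<^sup>+z. ennreal (?g z) \<partial>count_space UNIV) = 1" by simp
qed

lemma full_prob_eq_sum: "full_prob C p = (\<Sum>z\<in>full_states C. pmf p z)"
  unfolding full_prob_def by (rule measure_measure_pmf_finite) (simp add: full_states_eq)

lemma full_prob_product_form:
  assumes "a \<ge> 0" "b \<ge> 0"
  shows "full_prob C (product_form C a b) = (a + b) ^ C / fact C / mass C (a + b)"
proof -
  have "full_prob C (product_form C a b) = (\<Sum>z\<in>full_states C. weight a b z / mass C (a + b))"
    unfolding full_prob_eq_sum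
    by (intro sum.cong) (auto simp: pmf_product_form assms full_states_def)
  then show ?thesis by (simp add: sum_weight_full_states flip: sum_divide_distrib)
qed

section \<open>The drift and its zeros\<close>

lemma sum_states_shift1:
  "(\<Sum>z\<in>states C. real (fst z) * g z) = (\<Sum>(x, y)\<in>free_states C. real (x + 1) * g (x + 1, y))"
proof -
  let ?s = "\<lambda>(x, y). (x + 1, y) :: nat \<times> nat"
  \<comment> \<open>The factor \<open>x\<close> kills the axis \<open>x = 0\<close>, where the
    backward difference is junk; all other states are right neighbours of free states.\<close>
  have "(\<Sum>z\<in>states C. real (fst z) * g z) = (\<Sum>z\<in>?s ` free_states C. real (fst z) * g z)"
  proof (intro sum.mono_neutral_right finite_states)
    show "\<forall>z\<in>states C - ?s ` free_states C. real (fst z) * g z = 0"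
    proof
      fix z assume z: "z \<in> states C - ?s ` free_states C"
      have "fst z = 0"
      proof (rule ccontr)
        assume "fst z \<noteq> 0"
        with z have "z = ?s (fst z - 1, snd z)" "(fst z - 1, snd z) \<in> free_states C"
          by (auto simp: states_def free_states_def)
        with z show False by blast
      qed
      then show "real (fst z) * g z = 0" by simp
    qed
  qed (auto simp: states_def free_states_def)
  also have "\<dots> = (\<Sum>(x, y)\<in>free_states C. real (x + 1) * g (x + 1, y))"
    by (subst sum.reindex) (auto simp: inj_on_def intro!: sum.cong)
  finally show ?thesis .
qed

lemma sum_states_shift2:
  "(\<Sum>z\<in>states C. real (snd z) * g z) = (\<Sum>(x, y)\<in>free_states C. real (y + 1) * g (x, y + 1))"
proof -
  have swap: "bij_betw prod.swap (states C) (states C)" "bij_betw prod.swap (free_states C) (free_states C)"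
    by (rule bij_betw_byWitness[of _ prod.swap]; auto simp: states_def free_states_def)+
  have "(\<Sum>z\<in>states C. real (snd z) * g z) = (\<Sum>z\<in>states C. real (fst z) * g (prod.swap z))"
    by (subst sum.reindex_bij_betw[OF swap(1), symmetric]) simp
  also have "\<dots> = (\<Sum>(x, y)\<in>free_states C. real (x + 1) * g (y, x + 1))"
    by (simp add: sum_states_shift1[where g = "\<lambda>z. g (prod.swap z)"])
  also have "\<dots> = (\<Sum>(x, y)\<in>free_states C. real (y + 1) * g (x, y + 1))"
    by (subst sum.reindex_bij_betw[OF swap(2), symmetric]) (auto intro!: sum.cong)
  finally show ?thesis .
qed

text \<open>Summation by parts: each jump is paired with its reverse on the same edge, so the test
  function enters only through its increments.\<close>

lemma drift_flux_form:
  "drift C lam mu1 mu2 p f = (\<Sum>(x, y)\<in>free_states C.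
     (f (x + 1, y) - f (x, y)) * (lam * pmf p (x, y) - mu1 * real (x + 1) * pmf p (x + 1, y)) +
     (f (x, y + 1) - f (x, y)) *
       (lam * full_prob C p * pmf p (x, y) - mu2 * real (y + 1) * pmf p (x, y + 1)))"
proof -
  have up: "pairing C p (\<lambda>z. g z * indicator (free_states C) z) = (\<Sum>z\<in>free_states C. g z * pmf p z)"
    for g
    unfolding pairing_def
    by (rule sum.mono_neutral_cong_right) (auto simp: finite_states free_states_subset[THEN subsetD])
  have down1: "pairing C p (\<lambda>z. real (fst z) * g z)
      = (\<Sum>(x, y)\<in>free_states C. real (x + 1) * (g (x + 1, y) * pmf p (x + 1, y)))" for g
    unfolding pairing_def by (subst sum_states_shift1[symmetric]) (simp add: mult.assoc)
  have down2: "pairing C p (\<lambda>z. real (snd z) * g z)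
      = (\<Sum>(x, y)\<in>free_states C. real (y + 1) * (g (x, y + 1) * pmf p (x, y + 1)))" for g
    unfolding pairing_def by (subst sum_states_shift2[symmetric]) (simp add: mult.assoc)
  show ?thesis
    unfolding drift_def up down1 down2 sum_distrib_left sum.distrib[symmetric]
    by (intro sum.cong refl)
      (auto simp: nabla1_plus_def nabla2_plus_def nabla1_minus_def nabla2_minus_def algebra_simps)
qed

lemma mem_equilibria_iff:
  "p \<in> equilibria C lam mu1 mu2 \<longleftrightarrow> p \<in> distributions C \<and> (\<forall>f. drift C lam mu1 mu2 p f = 0)"
proof
  assume "p \<in> equilibria C lam mu1 mu2"
  then have p: "p \<in> distributions C" and
    d: "((\<lambda>s. pairing C p f) has_real_derivative drift C lam mu1 mu2 p f) (at 1 within {0..})" for f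
    by (auto simp: equilibria_def solves_D1_def)
  \<comment> \<open>At the interior time 1 the one-sided derivative is an ordinary one, hence
    unique.\<close>
  have "at 1 within {0..} = at (1::real)" by (rule at_within_interior) simp
  with d have "drift C lam mu1 mu2 p f = 0" for f
    using DERIV_unique[OF _ DERIV_const] by metis
  with p show "p \<in> distributions C \<and> (\<forall>f. drift C lam mu1 mu2 p f = 0)" by simp
qed (auto simp: equilibria_def solves_D1_def)

text \<open>If no state were full, testing with \<open>x + y > j\<close> would propagate the vanishing of \<open>p\<close> from
  the level \<open>x + y = j + 1\<close> down to \<open>x + y = j\<close>.\<close>

lemma full_prob_pos:
  assumes p: "p \<in> distributions C" and drift: "\<And>f. drift C lam mu1 mu2 p f = 0"
    and lam: "lam > 0"
  shows "full_prob C p > 0"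
proof (rule ccontr)
  assume "\<not> full_prob C p > 0"
  then have S: "full_prob C p = 0" by (simp add: full_prob_def zero_less_measure_iff)
  have level: "pmf p (x, y) = 0" if "x + y = C - k" "k \<le> C" for x y k
    using that
  proof (induction k arbitrary: x y)
    case 0
    have "\<forall>z\<in>full_states C. pmf p z = 0"
      using S unfolding full_prob_eq_sum by (subst (asm) sum_nonneg_eq_0_iff) (auto simp: full_states_eq)
    with 0 show ?case by (auto simp: full_states_def states_def free_states_def)
  next
    case (Suc k)
    define j where "j = C - Suc k"
    have IH: "pmf p (x, y) = 0" if "x + y = Suc j" for x y
      using Suc.IH[of x y] Suc.prems that by (simp add: j_def)
    \<comment> \<open>The test function increases only on edges from level \<open>j\<close> to
      \<open>j + 1\<close>. There the return fluxes vanish by \<open>IH\<close> and the upward flux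
      in \<open>y\<close> by \<open>S\<close>.\<close>
    have "(\<Sum>(x, y)\<in>free_states C. if x + y = j then lam * pmf p (x, y) else 0)
        = drift C lam mu1 mu2 p (\<lambda>(x, y). of_bool (x + y > j))"
      unfolding drift_flux_form S by (intro sum.cong refl) (auto simp: IH)
    also have "\<dots> = 0" by (rule drift)
    finally have "\<forall>z\<in>free_states C. (case z of (x, y) \<Rightarrow> if x + y = j then lam * pmf p (x, y) else 0) = 0"
      using lam by (subst (asm) sum_nonneg_eq_0_iff) (auto simp: finite_free_states)
    moreover have "(x, y) \<in> free_states C" "x + y = j"
      using Suc.prems by (auto simp: free_states_def j_def)
    ultimately show ?case using lam by fastforce
  qed
  have "pmf p z = 0" if "z \<in> states C" for z
    using that level[of "fst z" "snd z" "C - (fst z + snd z)"] by (auto simp: states_def)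
  moreover have "(\<Sum>z\<in>states C. pmf p z) = 1"
    using p by (intro sum_pmf_eq_1 finite_states) (auto simp: distributions_def)
  ultimately show False by simp
qed

text \<open>With \<open>p = h * w\<close> for the detailed-balance weights \<open>w\<close>, the flux form of the drift tested
  with \<open>h\<close> itself is minus a Dirichlet form, which forces \<open>h\<close> to be constant.\<close>

lemma drift_zero_imp_product_form:
  assumes p: "p \<in> distributions C" and drift: "\<And>f. drift C lam mu1 mu2 p f = 0"
    and pos: "lam > 0" "mu1 > 0" "mu2 > 0"
  shows "p = product_form C (lam / mu1) (lam / mu2 * full_prob C p)"
proof -
  define S where "S = full_prob C p"
  define a b where "a = lam / mu1" and "b = lam / mu2 * S"
  \<comment> \<open>Positivity of \<open>S\<close> makes all weights positive, so that division by
    \<open>w\<close> is legitimate.\<close>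
  have S: "S > 0" unfolding S_def using p drift pos(1) by (rule full_prob_pos)
  have ab: "a > 0" "b > 0" using pos S by (auto simp: a_def b_def)
  define w where "w = weight a b"
  have w: "w z > 0" for z using ab by (auto simp: w_def weight_def split: prod.split)
  define h where "h z = pmf p z / w z" for z
  have ph: "pmf p z = h z * w z" for z using w[of z] by (simp add: h_def)
  have bal1: "mu1 * real (x + 1) * w (x + 1, y) = lam * w (x, y)" for x y
  proof -
    have "w (x + 1, y) * real (x + 1) = a * w (x, y)"
      by (simp add: w_def weight_def fact_Suc del: of_nat_Suc)
    then show ?thesis using pos by (simp add: a_def mult_ac)
  qed
  have bal2: "mu2 * real (y + 1) * w (x, y + 1) = lam * S * w (x, y)" for x y
  proof -
    have "w (x, y + 1) * real (y + 1) = b * w (x, y)"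
      by (simp add: w_def weight_def fact_Suc del: of_nat_Suc)
    then show ?thesis using pos by (simp add: b_def mult_ac)
  qed
  \<comment> \<open>By detailed balance each edge flux is minus the increment of \<open>h\<close>
    times \<open>lam * w\<close> or \<open>lam * S * w\<close>; hence the squares.\<close>
  have "- drift C lam mu1 mu2 p h
      = (\<Sum>(x, y)\<in>free_states C. lam * w (x, y) * (h (x + 1, y) - h (x, y))\<^sup>2
           + lam * S * w (x, y) * (h (x, y + 1) - h (x, y))\<^sup>2)"
    unfolding drift_flux_form sum_negf[symmetric]
  proof (intro sum.cong refl, clarify)
    fix x y
    have "mu1 * real (x + 1) * pmf p (x + 1, y) = h (x + 1, y) * (lam * w (x, y))"
      unfolding ph bal1[symmetric] by (simp only: mult_ac)
    moreover have "mu2 * real (y + 1) * pmf p (x, y + 1) = h (x, y + 1) * (lam * S * w (x, y))"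
      unfolding ph bal2[symmetric] by (simp only: mult_ac)
    ultimately show "- ((h (x + 1, y) - h (x, y)) *
           (lam * pmf p (x, y) - mu1 * real (x + 1) * pmf p (x + 1, y)) +
         (h (x, y + 1) - h (x, y)) *
           (lam * full_prob C p * pmf p (x, y) - mu2 * real (y + 1) * pmf p (x, y + 1)))
      = lam * w (x, y) * (h (x + 1, y) - h (x, y))\<^sup>2
           + lam * S * w (x, y) * (h (x, y + 1) - h (x, y))\<^sup>2"
      by (simp only: S_def[symmetric]) (simp add: ph power2_eq_square algebra_simps)
  qed
  then have "(\<Sum>(x, y)\<in>free_states C. lam * w (x, y) * (h (x + 1, y) - h (x, y))\<^sup>2
           + lam * S * w (x, y) * (h (x, y + 1) - h (x, y))\<^sup>2) = 0"
    by (simp add: drift)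
  then have zero: "\<forall>z\<in>free_states C. (case z of (x, y) \<Rightarrow> lam * w (x, y) * (h (x + 1, y) - h (x, y))\<^sup>2
           + lam * S * w (x, y) * (h (x, y + 1) - h (x, y))\<^sup>2) = 0"
    using pos S w
    by (subst (asm) sum_nonneg_eq_0_iff)
      (auto simp: finite_free_states less_imp_le intro!: add_nonneg_nonneg mult_nonneg_nonneg)
  have step: "h (x + 1, y) = h (x, y) \<and> h (x, y + 1) = h (x, y)" if "x + y < C" for x y
  proof -
    have eq: "lam * w (x, y) * (h (x + 1, y) - h (x, y))\<^sup>2
           + lam * S * w (x, y) * (h (x, y + 1) - h (x, y))\<^sup>2 = 0"
      using zero that by (auto simp: free_states_def)
    have sq: "u = 0 \<and> v = 0" if "A * u\<^sup>2 + B * v\<^sup>2 = 0" "A > 0" "B > 0" for A B u v :: real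
      using that by (simp add: add_nonneg_eq_0_iff)
    show ?thesis using sq[OF eq] pos S w by simp
  qed
  \<comment> \<open>Every state is reached from the origin inside \<open>states C\<close>, first
    along the \<open>x\<close>-axis, then upwards.\<close>
  have hx: "h (x, 0) = h (0, 0)" if "x \<le> C" for x
    using that
  proof (induction x)
    case (Suc x)
    then show ?case using step[of x 0] by simp
  qed simp
  have hxy: "h (x, y) = h (0, 0)" if "x + y \<le> C" for x y
    using that
  proof (induction y)
    case 0
    then show ?case using hx[of x] by simp
  next
    case (Suc y)
    then show ?case using step[of x y] by simp
  qed
  have hz: "h z = h (0, 0)" if "z \<in> states C" for z
    using hxy[of "fst z" "snd z"] that by (auto simp: states_def)
  have "1 = (\<Sum>z\<in>states C. pmf p z)"
    using p by (intro sum_pmf_eq_1[symmetric] finite_states) (auto simp: distributions_def)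
  also have "\<dots> = (\<Sum>z\<in>states C. h (0, 0) * w z)"
  proof (rule sum.cong)
    fix z assume "z \<in> states C"
    then show "pmf p z = h (0, 0) * w z" using ph[of z] hz[of z] by simp
  qed simp
  also have "\<dots> = h (0, 0) * mass C (a + b)"
    by (simp add: w_def sum_weight_states flip: sum_distrib_left)
  finally have c: "h (0, 0) = 1 / mass C (a + b)"
    using mass_pos[of "a + b" C] ab by (simp add: field_simps)
  have "p = product_form C a b"
  proof (rule pmf_eqI)
    fix z
    show "pmf p z = pmf (product_form C a b) z"
    proof (cases "z \<in> states C")
      case True
      from hz[OF True] True show ?thesis using ab c by (simp add: pmf_product_form ph w_def)
    next
      case False
      with p have "z \<notin> set_pmf p" by (auto simp: distributions_def)
      with False show ?thesis using ab by (simp add: pmf_product_form set_pmf_iff)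
    qed
  qed
  then show ?thesis by (simp only: a_def b_def S_def)
qed

lemma product_form_drift_zero:
  assumes pos: "lam > 0" "mu1 > 0" "mu2 > 0" and S: "S \<ge> 0"
    and full: "full_prob C (product_form C (lam / mu1) (lam / mu2 * S)) = S"
  shows "drift C lam mu1 mu2 (product_form C (lam / mu1) (lam / mu2 * S)) f = 0"
  unfolding drift_flux_form
proof (rule sum.neutral, clarify)
  fix x y assume "(x, y) \<in> free_states C"
  then have xy: "(x, y) \<in> states C" "(x + 1, y) \<in> states C" "(x, y + 1) \<in> states C"
    by (auto simp: states_def free_states_def)
  define a b where "a = lam / mu1" and "b = lam / mu2 * S"
  have ab: "a \<ge> 0" "b \<ge> 0" and lam: "lam = mu1 * a" "lam * S = mu2 * b"
    using pos S by (auto simp: a_def b_def)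
  have "mu1 * real (x + 1) * weight a b (x + 1, y) = lam * weight a b (x, y)"
    unfolding lam by (simp add: weight_def fact_Suc del: of_nat_Suc)
  moreover have "mu2 * real (y + 1) * weight a b (x, y + 1) = lam * S * weight a b (x, y)"
    unfolding lam(2) by (simp add: weight_def fact_Suc del: of_nat_Suc)
  ultimately have
    "mu1 * real (x + 1) * pmf (product_form C a b) (x + 1, y) = lam * pmf (product_form C a b) (x, y)"
    "mu2 * real (y + 1) * pmf (product_form C a b) (x, y + 1) = lam * S * pmf (product_form C a b) (x, y)"
    by (simp_all only: pmf_product_form[OF ab] xy if_True times_divide_eq_right)
  then show "(f (x + 1, y) - f (x, y)) *
         (lam * pmf (product_form C (lam / mu1) (lam / mu2 * S)) (x, y) -
          mu1 * real (x + 1) * pmf (product_form C (lam / mu1) (lam / mu2 * S)) (x + 1, y)) +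
       (f (x, y + 1) - f (x, y)) *
         (lam * full_prob C (product_form C (lam / mu1) (lam / mu2 * S)) *
            pmf (product_form C (lam / mu1) (lam / mu2 * S)) (x, y) -
          mu2 * real (y + 1) * pmf (product_form C (lam / mu1) (lam / mu2 * S)) (x, y + 1)) = 0"
    unfolding full a_def b_def by simp
qed

lemma product_form_in_distributions:
  "a \<ge> 0 \<Longrightarrow> b \<ge> 0 \<Longrightarrow> product_form C a b \<in> distributions C"
  by (auto simp: distributions_def set_pmf_iff pmf_product_form split: if_splits)

text \<open>The drift is nonlinear only through the full probability. Freezing it at
  \<open>S\<close> leaves a reversible chain with product-form law, and \<open>S\<close> must then
  reproduce itself.\<close>

lemma equilibria_eq:
  assumes "lam > 0" "mu1 > 0" "mu2 > 0"
  shows "equilibria C lam mu1 mu2 = (\<lambda>S. product_form C (lam / mu1) (lam / mu2 * S)) `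
           {S. S > 0 \<and> full_prob C (product_form C (lam / mu1) (lam / mu2 * S)) = S}"
proof (intro equalityI subsetI)
  fix p assume "p \<in> equilibria C lam mu1 mu2"
  then have p: "p \<in> distributions C" "\<And>f. drift C lam mu1 mu2 p f = 0"
    by (auto simp: mem_equilibria_iff)
  show "p \<in> (\<lambda>S. product_form C (lam / mu1) (lam / mu2 * S)) `
           {S. S > 0 \<and> full_prob C (product_form C (lam / mu1) (lam / mu2 * S)) = S}"
    using drift_zero_imp_product_form[OF p assms] full_prob_pos[OF p assms(1)]
    by (intro image_eqI[of _ _ "full_prob C p"]) auto
next
  fix p assume "p \<in> (\<lambda>S. product_form C (lam / mu1) (lam / mu2 * S)) `
           {S. S > 0 \<and> full_prob C (product_form C (lam / mu1) (lam / mu2 * S)) = S}"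
  then show "p \<in> equilibria C lam mu1 mu2"
    using assms by (auto simp: mem_equilibria_iff simp del: times_divide_eq_left
        intro!: product_form_in_distributions product_form_drift_zero)
qed

section \<open>Equilibria as zeros of the gap, and their limits\<close>

lemma full_prob_product_form_fixpoint_iff:
  assumes "r > 0" "nu > 0" "S > 0"
  shows "full_prob C (product_form C r (nu * real C * S)) = S \<longleftrightarrow> gap r nu C S = 0"
proof -
  have b: "nu * real C * S \<ge> 0" using assms by simp
  then have "mass C (r + nu * real C * S) > 0"
    using assms by (intro mass_pos) auto
  then show ?thesis
    using assms b by (simp add: full_prob_product_form gap_def Let_def divide_eq_eq mult_ac)
qed

lemma eventually_gap_zero_set:
  assumes "r > 0" "nu > 4" "e > 0"
  defines "D \<equiv> sqrt (1 - 4 / nu)"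
  shows "\<forall>\<^sub>F C in sequentially. \<exists>s1 s2 s3. s1 < s2 \<and> s2 < s3 \<and>
           {z. z > 0 \<and> gap r nu C z = 0} = {s1, s2, s3} \<and>
           \<bar>s1\<bar> < e \<and> \<bar>s2 - (1 - D) / 2\<bar> < e \<and> \<bar>s3 - (1 + D) / 2\<bar> < e"
proof -
  have "\<forall>\<^sub>F C in sequentially. real C > r"
    by (rule eventually_compose_filterlim[OF eventually_gt_at_top filterlim_real_sequentially])
  with eventually_three_gap_zeros[OF assms(1-3)] show ?thesis
  proof eventually_elim
    case (elim C)
    then obtain s1 s2 s3 where s: "0 < s1" "s1 < s2" "s2 < s3"
      "gap r nu C s1 = 0" "gap r nu C s2 = 0" "gap r nu C s3 = 0"
      "\<bar>s1\<bar> < e" "\<bar>s2 - (1 - D) / 2\<bar> < e" "\<bar>s3 - (1 + D) / 2\<bar> < e"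
      unfolding D_def by blast
    have "{z. z > 0 \<and> gap r nu C z = 0} = {s1, s2, s3}"
    proof (rule three_point_set_eqI)
      fix x1 x2 x3 x4
      assume "x1 \<in> {z. z > 0 \<and> gap r nu C z = 0}" "x2 \<in> {z. z > 0 \<and> gap r nu C z = 0}"
        "x3 \<in> {z. z > 0 \<and> gap r nu C z = 0}" "x4 \<in> {z. z > 0 \<and> gap r nu C z = 0}"
        "x1 < x2" "x2 < x3" "x3 < x4"
      then show False
        using gap_no_four_zeros[of r nu C x1 x2 x3 x4] assms elim(2) by simp
    qed (use s in auto)
    with s show ?case by blast
  qed
qed

text \<open>Identifies the zeros obtained for different tolerances \<open>e\<close> with one fixed
  choice.\<close>

lemma three_point_set_sorted_unique:
  fixes s1 :: "'a::linorder"
  assumes "{s1, s2, s3} = {t1, t2, t3}" "s1 < s2" "s2 < s3" "t1 < t2" "t2 < t3"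
  shows "s1 = t1 \<and> s2 = t2 \<and> s3 = t3"
proof -
  have "s1 \<in> {t1, t2, t3}" "s2 \<in> {t1, t2, t3}" "s3 \<in> {t1, t2, t3}"
    using assms(1) by auto
  then show ?thesis using assms(2-5) by auto
qed

theorem proposition2p4:
  fixes rho1 nu2 :: real
  assumes "rho1 > 0" and "nu2 > 0" and "nu2 > max 4 (exp 1 / rho1)"
  shows "\<exists>C0>0. \<exists>P1 P2 P3 :: nat \<Rightarrow> (nat \<times> nat) pmf.
           (\<forall>C\<ge>C0. \<forall>lam mu1 mu2 :: real.
              lam > 0 \<and> mu1 > 0 \<and> mu2 > 0 \<and> lam / mu1 = rho1 \<and> lam / mu2 = nu2 * real C \<longrightarrow>
                equilibria C lam mu1 mu2 = {P1 C, P2 C, P3 C} \<and>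
                card (equilibria C lam mu1 mu2) = 3) \<and>
           (\<lambda>C. full_prob C (P1 C)) \<longlonglongrightarrow> 0 \<and>
           (\<lambda>C. full_prob C (P2 C)) \<longlonglongrightarrow> (1 - sqrt (1 - 4 / nu2)) / 2 \<and>
           (\<lambda>C. full_prob C (P3 C)) \<longlonglongrightarrow> (1 + sqrt (1 - 4 / nu2)) / 2"
proof -
  have nu: "nu2 > 4" using assms by simp
  define D where "D = sqrt (1 - 4 / nu2)"
  define Z where "Z C = {z. z > 0 \<and> gap rho1 nu2 C z = 0}" for C
  note zeros = eventually_gap_zero_set[OF assms(1) nu, folded D_def, folded Z_def]
  \<comment> \<open>The tolerance 1 is arbitrary: it only yields three zeros, chosen as functions of
    \<open>C\<close> alone; \<open>near\<close> then supplies every tolerance.\<close>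
  obtain C1 where "\<forall>C\<ge>C1. \<exists>s1 s2 s3. s1 < s2 \<and> s2 < s3 \<and> Z C = {s1, s2, s3}"
    using zeros[of 1] unfolding eventually_sequentially by (metis zero_less_one)
  then obtain s1 s2 s3 where s: "s1 C < s2 C" "s2 C < s3 C" "Z C = {s1 C, s2 C, s3 C}"
    if "C \<ge> C1" for C by metis
  have near: "\<forall>\<^sub>F C in sequentially.
      \<bar>s1 C\<bar> < e \<and> \<bar>s2 C - (1 - D) / 2\<bar> < e \<and> \<bar>s3 C - (1 + D) / 2\<bar> < e" if "e > 0" for e
    using zeros[OF that] eventually_ge_at_top[of C1]
  proof eventually_elim
    case (elim C)
    then obtain t1 t2 t3 where t: "t1 < t2" "t2 < t3" "Z C = {t1, t2, t3}"
      "\<bar>t1\<bar> < e" "\<bar>t2 - (1 - D) / 2\<bar> < e" "\<bar>t3 - (1 + D) / 2\<bar> < e" by blast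
    then have "s1 C = t1 \<and> s2 C = t2 \<and> s3 C = t3"
      using s[OF elim(2)] by (intro three_point_set_sorted_unique) auto
    with t show ?case by simp
  qed
  have lims: "s1 \<longlonglongrightarrow> 0" "s2 \<longlonglongrightarrow> (1 - D) / 2" "s3 \<longlonglongrightarrow> (1 + D) / 2"
    by (rule tendstoI, drule near, elim eventually_mono, simp add: dist_real_def)+
  \<comment> \<open>\<open>Q\<close> depends on the rates only through \<open>rho1\<close> and
    \<open>nu2\<close>, so the same three families serve all \<open>lam\<close>, \<open>mu1\<close>,
    \<open>mu2\<close> with these ratios.\<close>
  define Q where "Q C S = product_form C rho1 (nu2 * real C * S)" for C S
  have Z_iff: "S \<in> Z C \<longleftrightarrow> S > 0 \<and> full_prob C (Q C S) = S" for C S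
    using full_prob_product_form_fixpoint_iff[of rho1 nu2 S C] assms by (auto simp: Z_def Q_def)
  have Z_s: "s1 C \<in> Z C" "s2 C \<in> Z C" "s3 C \<in> Z C" if "C \<ge> C1" for C
    using s(3)[OF that] by auto
  have lim_Q: "(\<lambda>C. full_prob C (Q C (u C))) \<longlonglongrightarrow> l"
    if "u \<longlonglongrightarrow> l" "\<And>C. C \<ge> C1 \<Longrightarrow> u C \<in> Z C" for u l
    using that by (intro Lim_transform_eventually[OF that(1)] eventually_sequentiallyI[of C1]) (simp add: Z_iff)
  have equi: "equilibria C lam mu1 mu2 = {Q C (s1 C), Q C (s2 C), Q C (s3 C)} \<and>
      card (equilibria C lam mu1 mu2) = 3"
    if C: "C \<ge> C1" and pos: "lam > 0" "mu1 > 0" "mu2 > 0"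
      and ratios: "lam / mu1 = rho1" "lam / mu2 = nu2 * real C" for C lam mu1 mu2
  proof -
    have eq: "equilibria C lam mu1 mu2 = Q C ` Z C"
      unfolding equilibria_eq[OF pos] ratios Q_def[symmetric]
      by (intro arg_cong[where f = "image (Q C)"]) (auto simp: Z_iff)
    \<comment> \<open>On zeros of the gap \<open>full_prob C\<close> recovers \<open>S\<close> from
      \<open>Q C S\<close>, so distinct zeros give distinct equilibria.\<close>
    have "inj_on (Q C) (Z C)" by (rule inj_on_inverseI[of _ "full_prob C"]) (simp add: Z_iff)
    then have "card (equilibria C lam mu1 mu2) = card (Z C)" by (simp add: eq card_image)
    also have "\<dots> = 3" using s[OF C] by auto
    finally show ?thesis using eq s(3)[OF C] by simp
  qed
  \<comment> \<open>The successor ensures that the threshold is positive.\<close>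
  have "\<forall>C\<ge>Suc C1. \<forall>lam mu1 mu2 :: real.
      lam > 0 \<and> mu1 > 0 \<and> mu2 > 0 \<and> lam / mu1 = rho1 \<and> lam / mu2 = nu2 * real C \<longrightarrow>
        equilibria C lam mu1 mu2 = {Q C (s1 C), Q C (s2 C), Q C (s3 C)} \<and>
        card (equilibria C lam mu1 mu2) = 3"
    by (intro allI impI, elim conjE, rule equi) simp_all
  note facts = zero_less_Suc this lim_Q[OF lims(1) Z_s(1)] lim_Q[OF lims(2) Z_s(2), unfolded D_def]
    lim_Q[OF lims(3) Z_s(3), unfolded D_def]
  show ?thesis
    by (rule exI[of _ "Suc C1"], rule conjI[OF facts(1)], rule exI[of _ "\<lambda>C. Q C (s1 C)"],
        rule exI[of _ "\<lambda>C. Q C (s2 C)"], rule exI[of _ "\<lambda>C. Q C (s3 C)"],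
        intro conjI facts)
qed

end
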